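(* Let $D$ be an oriented graph with $\mathrm{inv}(D)=k \ge 3$. Then the following propositions are equivalent. (1) $\mathrm{inv}(\overrightarrow{C_3} \Rightarrow D) = k$. (2) $k$ is odd and there exists a $k$-decycling family of $D$ whose set of characteristic vectors $\Lambda=\{\mathbf{z} : z \in V(D)\}$ satisfies $\Lambda \subset \{x \in \mathbb{F}_2^k : x \cdot \mathbf{1}=0\}$, where $\mathbf{1}\in\mathbb{F}_2^k$ is the all-ones vector.
   Context: All digraphs are finite and have no loops, parallel arcs or 2-cycles (i.e. they are oriented graphs). $\overrightarrow{C_3}$ denotes the directed cycle on three vertices. For a digraph $D$ with vertex set $V(D)$ and a subset $X\subseteq V(D)$, the inversion of $X$ in $D$ is the digraph $\mathrm{Inv}(D;X)$ obtained from $D$ by reversing the direction of all arcs with both ends in $X$. For a finite family $(X_i)_{i\in I}$ of subsets of $V(D)$, $\mathrm{Inv}(D;(X_i)_{i\in I})$ is obtained by inverting the sets $X_i$ one after another (the order does not matter). The family is a decycling family if $\mathrm{Inv}(D;(X_i)_{i\in I})$ is acyclic, and a $k$-decycling family if moreover $|I|=k$. The inversion number $\mathrm{inv}(D)$ is the minimum cardinality $|I|$ of a decycling family of $D$. For (vertex-disjoint) oriented graphs $L,R$, the dijoin $L\Rightarrow R$ is the oriented graph obtained from the disjoint union of $L$ and $R$ by adding all arcs $uv$ with $u\in V(L)$, $v\in V(R)$. Given a decycling family $(X_i)_{1\le i\le k}$ of $D$ and a vertex $v\in V(D)$, the characteristic vector $\mathbf{v}\in\mathbb{F}_2^k$ of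 $v$ is the vector whose $i$-th entry is $1$ if and only if $v\in X_i$. The product $x\cdot y$ is the standard scalar product over $\mathbb{F}_2$. The symbol $\subset$ allows equality. *)

theory Defs
  imports
    "HOL-Library.Z2"
    "Graph_Theory.Pair_Digraph"
    "Jordan_Normal_Form.Matrix"
begin

text \<open>
  Arcs are pairs of vertices, so there are no parallel arcs; \<^locale>\<open>pair_digraph\<close> provides
  finiteness and the absence of loops.
\<close>

locale oriented_graph = pair_digraph +
  assumes no_2cycle: "(u, v) \<in> parcs G \<Longrightarrow> (v, u) \<notin> parcs G"

definition C3 :: "nat pair_pre_digraph" where
  "C3 = \<lparr> pverts = {0, 1, 2}, parcs = {(0, 1), (1, 2), (2, 0)} \<rparr>"

text \<open>The sum type makes the two vertex sets disjoint.\<close>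

definition dijoin :: "'a pair_pre_digraph \<Rightarrow> 'b pair_pre_digraph \<Rightarrow> ('a + 'b) pair_pre_digraph"
  where
  "dijoin L R =
     \<lparr> pverts = Inl ` pverts L \<union> Inr ` pverts R,
       parcs = {(Inl u, Inl v) | u v. (u, v) \<in> parcs L}
             \<union> {(Inr u, Inr v) | u v. (u, v) \<in> parcs R}
             \<union> {(Inl u, Inr v) | u v. u \<in> pverts L \<and> v \<in> pverts R} \<rparr>"

definition inversion :: "'a pair_pre_digraph \<Rightarrow> 'a set \<Rightarrow> 'a pair_pre_digraph" where
  "inversion D X =
     \<lparr> pverts = pverts D,
       parcs = {(u, v). if u \<in> X \<and> v \<in> X then (v, u) \<in> parcs D else (u, v) \<in> parcs D} \<rparr>"

text \<open>
  A family of \<open>k\<close> sets is a list of length \<open>k\<close>; repetitions are allowed.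
\<close>

definition Inv :: "'a pair_pre_digraph \<Rightarrow> 'a set list \<Rightarrow> 'a pair_pre_digraph" where
  "Inv D Xs = foldl inversion D Xs"

definition decycling_family :: "'a pair_pre_digraph \<Rightarrow> 'a set list \<Rightarrow> bool" where
  "decycling_family D Xs \<longleftrightarrow> (\<forall>X\<in>set Xs. X \<subseteq> pverts D) \<and> acyclic (parcs (Inv D Xs))"

definition k_decycling_family :: "nat \<Rightarrow> 'a pair_pre_digraph \<Rightarrow> 'a set list \<Rightarrow> bool" where
  "k_decycling_family k D Xs \<longleftrightarrow> decycling_family D Xs \<and> length Xs = k"

text \<open>
  The minimum is attained for every oriented graph: see \<open>ex_decycling_family\<close> below.
\<close>

definition inversion_number :: "'a pair_pre_digraph \<Rightarrow> nat" where
  "inversion_number D = (LEAST k. \<exists>Xs. k_decycling_family k D Xs)"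

definition char_vec :: "'a set list \<Rightarrow> 'a \<Rightarrow> bit vec" where
  "char_vec Xs v = vec (length Xs) (\<lambda>i. if v \<in> Xs ! i then 1 else 0)"

definition ones_vec :: "nat \<Rightarrow> bit vec" where
  "ones_vec k = vec k (\<lambda>i. 1)"

lemma inversion_commute: "inversion (inversion D X) Y = inversion (inversion D Y) X"
  by (auto simp: inversion_def)

lemma oriented_graph_C3: "oriented_graph C3"
  by unfold_locales (auto simp: C3_def)

lemma oriented_graph_inversion:
  assumes "oriented_graph D"
  shows "oriented_graph (inversion D X)"
proof -
  interpret oriented_graph D by fact
  have "parcs (inversion D X) \<subseteq> pverts D \<times> pverts D"
    by (auto simp: inversion_def wellformed' split: if_splits)
  then have "finite (parcs (inversion D X))"
    using finite_subset pair_finite_verts by blast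
  then show ?thesis
    by unfold_locales
      (auto simp: inversion_def wellformed' no_2cycle pair_finite_verts dest: pair_no_loops
         split: if_splits)
qed

lemma oriented_graph_dijoin:
  assumes "oriented_graph L" "oriented_graph R"
  shows "oriented_graph (dijoin L R)"
proof -
  interpret L: oriented_graph L by fact
  interpret R: oriented_graph R by fact
  have "parcs (dijoin L R) \<subseteq> pverts (dijoin L R) \<times> pverts (dijoin L R)"
    by (auto simp: dijoin_def L.wellformed' R.wellformed')
  moreover have fin: "finite (pverts (dijoin L R))"
    by (simp add: dijoin_def L.pair_finite_verts R.pair_finite_verts)
  ultimately have "finite (parcs (dijoin L R))"
    using finite_subset by blast
  with fin show ?thesis
    by unfold_locales
      (auto simp: dijoin_def L.wellformed' R.wellformed' L.no_2cycle R.no_2cycle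
         dest: L.pair_no_loops R.pair_no_loops)
qed

lemma ex_decycling_family:
  assumes "oriented_graph D"
  shows "\<exists>Xs. decycling_family D Xs"
proof -
  have "finite (pverts D)"
    using assms by (simp add: oriented_graph_def pair_digraph_def
        pair_fin_digraph.pair_finite_verts)
  then obtain f :: "'a \<Rightarrow> nat" where f: "inj_on f (pverts D)"
    using finite_imp_inj_to_nat_seg by metis
  define bwd where "bwd D = {(u, v) \<in> parcs D. f v < f u}" for D :: "'a pair_pre_digraph"
  from assms f show ?thesis
  proof (induction "card (bwd D)" arbitrary: D rule: less_induct)
    case less
    interpret oriented_graph D by fact
    show ?case
    proof (cases "bwd D = {}")
      case True
      have "f u < f v" if "(u, v) \<in> parcs D" for u v
        using that True less.prems(2) wellformed' pair_no_loops[OF that]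
        by (auto simp: bwd_def inj_on_def) (metis linorder_neqE_nat)
      then have "parcs D \<subseteq> measure f" by auto
      then have "acyclic (parcs D)"
        using acyclic_subset wf_acyclic wf_measure by blast
      then have "decycling_family D []" by (simp add: decycling_family_def Inv_def)
      then show ?thesis ..
    next
      case False
      then obtain u v where uv: "(u, v) \<in> parcs D" "f v < f u" by (auto simp: bwd_def)
      let ?D = "inversion D {u, v}"
      have "bwd ?D \<subseteq> bwd D - {(u, v)}"
        using uv no_2cycle[OF uv(1)] by (auto simp: bwd_def inversion_def split: if_splits)
      moreover have "(u, v) \<in> bwd D" using uv by (simp add: bwd_def)
      ultimately have "bwd ?D \<subset> bwd D" by blast
      moreover have "finite (bwd D)"
        using pair_finite_arcs by (rule rev_finite_subset) (auto simp: bwd_def)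
      ultimately have "card (bwd ?D) < card (bwd D)" by (simp add: psubset_card_mono)
      moreover have "inj_on f (pverts ?D)" using less.prems(2) by (simp add: inversion_def)
      ultimately obtain Xs where "decycling_family ?D Xs"
        using less.hyps oriented_graph_inversion[OF less.prems(1)] by blast
      moreover have "{u, v} \<subseteq> pverts D" using uv(1) wellformed' by blast
      ultimately have "decycling_family D ({u, v} # Xs)"
        by (auto simp: decycling_family_def Inv_def inversion_def)
      then show ?thesis ..
    qed
  qed
qed

end

theory Submission
  imports Defs
begin

text \<open>
  A family of \<open>k\<close> sets labels every vertex by a vector over the two-element field, and inverting the
  family reverses exactly the arcs whose two end labels have product \<open>1\<close>. So a \<open>k\<close>-decycling family is
  a labelling by \<open>k\<close>-dimensional vectors, and only the products of labels matter. The proof rests on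
  three observations about such labellings.

  Suppose first that \<open>L\<close> contains a directed cycle and that \<open>L \<Rightarrow> D\<close> is decycled with \<open>k\<close> sets. Some arc
  \<open>p \<rightarrow> x\<close> of \<open>L\<close> was reversed, so the labels satisfy \<open>x \<bullet> p = 1\<close>. In the acyclic reorientation the
  vertices of \<open>D\<close> fall into three classes, those before \<open>x\<close>, those between \<open>x\<close> and \<open>p\<close>, and those after
  \<open>p\<close>, and the class of a vertex can be read off from its products with \<open>x\<close> and \<open>p\<close>. Adding \<open>p\<close> to every
  label of the first class makes all labels orthogonal to \<open>x\<close>. Its only effects on the arcs are that
  the first class may be reversed as a whole and that it changes places with the second class, so
  the result is still acyclic (\<open>dijoin_labelling_hyperplane\<close>).

  Suppose next that all labels of a decycling labelling of \<open>D\<close> are orthogonal to a nonzero vector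
  \<open>u\<close> with support \<open>S\<close>. If some coordinate \<open>m\<close> leaves \<open>S - {m}\<close> with odd cardinality, then adding
  coordinate \<open>m\<close> to the coordinates in \<open>S - {m}\<close> and deleting \<open>m\<close> preserves all products, so one set
  fewer suffices (\<open>drop_coordinate\<close>). Such an \<open>m\<close> can be taken in \<open>S\<close> if the cardinality of \<open>S\<close> is even
  and outside \<open>S\<close>, unless \<open>S\<close> is everything, if it is odd. Hence, when \<open>k = inv(D)\<close>, the vector \<open>u\<close> is the all-ones vector and \<open>k\<close>
  is odd (\<open>minimal_labelling_hyperplane\<close>). Together these two observations give
  the implication from left to right.

  Conversely, if \<open>k\<close> is odd and all labels are orthogonal to the all-ones vector, that vector has
  product \<open>1\<close> with itself and \<open>0\<close> with the labels of \<open>D\<close>. Labelling two vertices of the triangle by it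
  and the third by \<open>0\<close> reverses a single arc of the triangle and no arc between the triangle and \<open>D\<close>
  (\<open>dijoin_C3_labelling\<close>).
\<close>

(* These rules rewrite sums and products of bits into bitwise operations, out of reach of the field laws. *)
declare add_bit_eq_xor [simp del] mult_bit_eq_and [simp del]

section \<open>Decycling families as vertex labellings\<close>

definition reorient :: "'a pair_pre_digraph \<Rightarrow> ('a \<Rightarrow> 'a \<Rightarrow> bit) \<Rightarrow> 'a rel" where
  "reorient D q = {(u, v). if q u v = 1 then (v, u) \<in> parcs D else (u, v) \<in> parcs D}"

definition dot :: "'i set \<Rightarrow> ('i \<Rightarrow> bit) \<Rightarrow> ('i \<Rightarrow> bit) \<Rightarrow> bit" where
  "dot I x y = (\<Sum>i\<in>I. x i * y i)"

text \<open>
  An arbitrary index set \<open>I\<close> in place of \<open>{..<k}\<close> lets a coordinate be deleted without renumbering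
  the others.
\<close>

definition decycling_labelling :: "'a pair_pre_digraph \<Rightarrow> 'i set \<Rightarrow> ('a \<Rightarrow> 'i \<Rightarrow> bit) \<Rightarrow> bool" where
  "decycling_labelling D I f \<longleftrightarrow> acyclic (reorient D (\<lambda>u v. dot I (f u) (f v)))"

lemma dot_commute: "dot I x y = dot I y x"
  by (simp add: dot_def mult.commute)

lemma dot_add_left: "dot I (\<lambda>i. x i + y i) z = dot I x z + dot I y z"
  by (simp add: dot_def distrib_right sum.distrib)

lemma dot_add_right: "dot I x (\<lambda>i. y i + z i) = dot I x y + dot I x z"
  by (simp add: dot_def distrib_left sum.distrib)

lemma of_nat_bit: "of_nat n = (of_bool (odd n) :: bit)"
  by (induction n) auto

lemma sum_const_bit: "(\<Sum>i\<in>A. c :: bit) = (if odd (card A) then c else 0)"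
  by (simp add: of_nat_bit)

text \<open>
  Each arc is reversed once for every set that contains both of its ends, and the product of the
  two characteristic vectors is the parity of the number of these sets.
\<close>

lemma parcs_Inv:
  "parcs (Inv D Xs) =
     reorient D (\<lambda>u v. dot {..<length Xs} (\<lambda>i. of_bool (u \<in> Xs ! i)) (\<lambda>i. of_bool (v \<in> Xs ! i)))"
proof (induction Xs rule: rev_induct)
  case Nil
  show ?case by (simp add: Inv_def reorient_def dot_def)
next
  case (snoc X Xs)
  let ?d = "\<lambda>Xs u v. dot {..<length Xs} (\<lambda>i. of_bool (u \<in> Xs ! i)) (\<lambda>i. of_bool (v \<in> Xs ! i))"
  have d: "?d (Xs @ [X]) u v = ?d Xs u v + of_bool (u \<in> X \<and> v \<in> X)" for u v
    by (auto simp: dot_def nth_append)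
  have comm: "?d Xs u v = ?d Xs v u" for u v by (rule dot_commute)
  have "parcs (Inv D (Xs @ [X])) = parcs (inversion (Inv D Xs) X)"
    by (simp add: Inv_def)
  also have "\<dots> = {(u, v). if u \<in> X \<and> v \<in> X then (v, u) \<in> reorient D (?d Xs)
                            else (u, v) \<in> reorient D (?d Xs)}"
    by (simp add: inversion_def snoc.IH)
  also have "\<dots> = reorient D (?d (Xs @ [X]))"
    unfolding reorient_def d using comm
    by (auto simp: split: if_splits)
  finally show ?case .
qed

lemma labelling_of_family:
  assumes "k_decycling_family k D Xs"
  shows "decycling_labelling D {..<k} (\<lambda>z i. of_bool (z \<in> Xs ! i))"
  using assms
  by (auto simp: k_decycling_family_def decycling_family_def decycling_labelling_def parcs_Inv)

lemma decycling_labelling_cong: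
  assumes "oriented_graph D"
    and "\<And>u v. u \<in> pverts D \<Longrightarrow> v \<in> pverts D \<Longrightarrow> dot I (f u) (f v) = dot J (g u) (g v)"
  shows "decycling_labelling D I f \<longleftrightarrow> decycling_labelling D J g"
proof -
  interpret oriented_graph D by fact
  have "reorient D (\<lambda>u v. dot I (f u) (f v)) = reorient D (\<lambda>u v. dot J (g u) (g v))"
    using assms(2) wellformed' by (auto simp: reorient_def split: if_splits)
  then show ?thesis by (simp add: decycling_labelling_def)
qed

text \<open>
  The coordinates of a labelling are indicator functions of sets. The coordinate sum, which is the
  product with the all-ones vector, is recorded because it survives the enumeration of \<open>I\<close>.
\<close>

lemma family_of_labelling:
  assumes D: "oriented_graph D" and I: "finite I" "card I = k" and f: "decycling_labelling D I f"
  shows "\<exists>Xs. k_decycling_family k D Xs \<and>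
           (\<forall>z\<in>pverts D. char_vec Xs z \<bullet> ones_vec k = (\<Sum>i\<in>I. f z i))"
proof -
  obtain h where h: "bij_betw h {..<k} I"
    using I ex_bij_betw_nat_finite[of I] by (auto simp: atLeast0LessThan)
  define Xs where "Xs = map (\<lambda>j. {z \<in> pverts D. f z (h j) = 1}) [0..<k]"
  have len: "length Xs = k" by (simp add: Xs_def)
  have mem: "of_bool (z \<in> Xs ! j) = f z (h j)" if "z \<in> pverts D" "j < k" for z j
    using that by (cases "f z (h j)") (auto simp: Xs_def)
  have "dot I (f u) (f v) =
      dot {..<length Xs} (\<lambda>i. of_bool (u \<in> Xs ! i)) (\<lambda>i. of_bool (v \<in> Xs ! i))"
    if "u \<in> pverts D" "v \<in> pverts D" for u v
    using sum.reindex_bij_betw[OF h, of "\<lambda>i. f u i * f v i", symmetric] that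
    by (simp add: dot_def len mem)
  from iffD1[OF decycling_labelling_cong[OF D this] f]
  have "acyclic (parcs (Inv D Xs))" by (simp add: decycling_labelling_def parcs_Inv)
  then have "k_decycling_family k D Xs"
    by (auto simp: k_decycling_family_def decycling_family_def Xs_def)
  moreover have "char_vec Xs z \<bullet> ones_vec k = (\<Sum>i\<in>I. f z i)" if "z \<in> pverts D" for z
  proof -
    have "char_vec Xs z \<bullet> ones_vec k = (\<Sum>j<k. of_bool (z \<in> Xs ! j))"
      by (simp add: scalar_prod_def char_vec_def ones_vec_def len atLeast0LessThan of_bool_def)
    also have "\<dots> = (\<Sum>j<k. f z (h j))" using mem that by simp
    also have "\<dots> = (\<Sum>i\<in>I. f z i)" by (rule sum.reindex_bij_betw[OF h])
    finally show ?thesis .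
  qed
  ultimately show ?thesis by blast
qed

lemma inversion_number_le: "k_decycling_family k D Xs \<Longrightarrow> inversion_number D \<le> k"
  unfolding inversion_number_def by (rule Least_le) blast

lemma inversion_number_attained:
  assumes "oriented_graph D"
  shows "\<exists>Xs. k_decycling_family (inversion_number D) D Xs"
proof -
  have "\<exists>k Xs. k_decycling_family k D Xs"
    using ex_decycling_family[OF assms] by (auto simp: k_decycling_family_def)
  then show ?thesis unfolding inversion_number_def by (rule LeastI_ex)
qed

lemma inversion_number_le_labelling:
  assumes "oriented_graph D" "finite I" "decycling_labelling D I f"
  shows "inversion_number D \<le> card I"
  using family_of_labelling[OF assms(1,2) refl assms(3)] inversion_number_le by blast

section \<open>Labels in a hyperplane\<close>

text \<open>
  Write \<open>T = S - {m}\<close> and let \<open>x\<close>, \<open>y\<close> be labels. Adding coordinate \<open>m\<close> to the coordinates in \<open>T\<close>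
  changes the product over \<open>I - {m}\<close> by
  \<open>x\<^sub>m * (\<Sum>i\<in>T. y\<^sub>i) + y\<^sub>m * (\<Sum>i\<in>T. x\<^sub>i) + x\<^sub>m * y\<^sub>m\<close>, the last coefficient being \<open>1\<close> because \<open>T\<close> has odd size.
  Both sums over \<open>T\<close> vanish if \<open>m \<notin> S\<close>, and they equal \<open>y\<^sub>m\<close> and \<open>x\<^sub>m\<close> if \<open>m \<in> S\<close>. Either way the
  change is \<open>x\<^sub>m * y\<^sub>m\<close>, exactly the term lost with coordinate \<open>m\<close>.
\<close>

lemma drop_coordinate:
  assumes D: "oriented_graph D" and I: "finite I" and f: "decycling_labelling D I f"
    and S: "S \<subseteq> I" and m: "m \<in> I" and odd: "odd (card (S - {m}))"
    and even_on_S: "\<And>z. z \<in> pverts D \<Longrightarrow> (\<Sum>i\<in>S. f z i) = 0"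
  shows "inversion_number D < card I"
proof -
  define T where "T = S - {m}"
  define g where "g z i = f z i + of_bool (i \<in> T) * f z m" for z i
  have T: "T \<subseteq> I - {m}" "finite T" using S I by (auto simp: T_def intro: finite_subset)
  have sumT: "(\<Sum>i\<in>T. f z i) = of_bool (m \<in> S) * f z m" if "z \<in> pverts D" for z
  proof -
    have "(\<Sum>i\<in>S. f z i) = of_bool (m \<in> S) * f z m + (\<Sum>i\<in>T. f z i)"
      using sum.remove[of S m "f z"] finite_subset[OF S I] by (simp add: T_def)
    then show ?thesis using even_on_S[OF that] by (cases "f z m") (auto simp: add_eq_0_iff)
  qed
  have "dot I (f u) (f v) = dot (I - {m}) (g u) (g v)"
    if uv: "u \<in> pverts D" "v \<in> pverts D" for u v
  proof -
    have restr: "(\<Sum>i\<in>I - {m}. of_bool (i \<in> T) * h i) = (\<Sum>i\<in>T. h i)" for h :: "_ \<Rightarrow> bit"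
      using T I by (intro sum.mono_neutral_cong_right) auto
    have "dot (I - {m}) (g u) (g v) =
        (\<Sum>i\<in>I - {m}. f u i * f v i + of_bool (i \<in> T) * (f u m * f v i + f v m * f u i + f u m * f v m))"
      unfolding dot_def g_def by (intro sum.cong) (auto simp: algebra_simps)
    also have "\<dots> = (\<Sum>i\<in>I - {m}. f u i * f v i)
        + (f u m * (\<Sum>i\<in>T. f v i) + f v m * (\<Sum>i\<in>T. f u i) + f u m * f v m)"
      using odd by (simp only: sum.distrib restr sum_const_bit sum_distrib_left flip: T_def) (simp add: T_def)
    also have "\<dots> = (\<Sum>i\<in>I - {m}. f u i * f v i) + f u m * f v m"
      using uv by (simp add: sumT)
    also have "\<dots> = dot I (f u) (f v)"
      using sum.remove[OF I m, of "\<lambda>i. f u i * f v i"] by (simp add: dot_def add.commute)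
    finally show ?thesis ..
  qed
  from iffD1[OF decycling_labelling_cong[OF D this] f]
  have "inversion_number D \<le> card (I - {m})"
    using inversion_number_le_labelling[OF D] I by blast
  then show ?thesis using I m by (meson card_Diff1_less le_less_trans)
qed

text \<open>
  By minimality no coordinate \<open>m\<close> can be dropped, so every \<open>S - {m}\<close> has even size, where \<open>S\<close> is the
  support of \<open>u\<close>. For \<open>m\<close> in \<open>S\<close> this makes the size of \<open>S\<close> odd, and then no \<open>m\<close> can lie outside \<open>S\<close>.
\<close>

lemma minimal_labelling_hyperplane:
  assumes D: "oriented_graph D" and I: "finite I" and f: "decycling_labelling D I f"
    and min: "inversion_number D = card I"
    and u: "i\<^sub>0 \<in> I" "u i\<^sub>0 = 1"
    and orth: "\<And>z. z \<in> pverts D \<Longrightarrow> dot I u (f z) = 0"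
  shows "odd (card I) \<and> (\<forall>i\<in>I. u i = 1)"
proof -
  define S where "S = {i \<in> I. u i = 1}"
  have S: "S \<subseteq> I" "finite S" using I by (auto simp: S_def)
  have sumS: "(\<Sum>i\<in>S. f z i) = 0" if "z \<in> pverts D" for z
  proof -
    have "(\<Sum>i\<in>S. f z i) = dot I u (f z)"
      unfolding dot_def S_def using I by (intro sum.mono_neutral_cong_left) auto
    then show ?thesis using orth[OF that] by simp
  qed
  have no: "even (card (S - {m}))" if "m \<in> I" for m
    using drop_coordinate[OF D I f S(1) that _ sumS] min by auto
  have "i\<^sub>0 \<in> S" using u by (simp add: S_def)
  then have "card S = Suc (card (S - {i\<^sub>0}))" by (rule card.remove[OF S(2)])
  then have odd: "odd (card S)" using no[OF u(1)] by (simp only: even_Suc not_not)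
  have "S = I"
  proof (rule ccontr)
    assume "S \<noteq> I"
    then obtain m where "m \<in> I" "m \<notin> S" using S by blast
    then show False using no[of m] odd by simp
  qed
  then show ?thesis using odd by (auto simp: S_def)
qed

section \<open>Acyclicity by levels\<close>

lemma acyclic_inv_image:
  assumes "acyclic R"
  shows "acyclic (inv_image R f)"
proof -
  have "(f a, f b) \<in> R\<^sup>+" if "(a, b) \<in> (inv_image R f)\<^sup>+" for a b
    using that by induction (auto intro: trancl.intros)
  then show ?thesis using assms by (auto simp: acyclic_def)
qed

text \<open>
  A cycle cannot leave its level, since the rank never decreases along an arc.
\<close>

lemma acyclic_levels:
  fixes r :: "'a \<Rightarrow> nat"
  assumes mono: "\<And>a b. (a, b) \<in> R \<Longrightarrow> r a \<le> r b"
    and level: "\<And>n. acyclic {(a, b) \<in> R. r a = n \<and> r b = n}"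
  shows "acyclic R"
proof -
  have *: "r a \<le> r b \<and> (r a = r b \<longrightarrow> (a, b) \<in> {(x, y) \<in> R. r x = r a \<and> r y = r a}\<^sup>+)"
    if "(a, b) \<in> R\<^sup>+" for a b
    using that
  proof induction
    case (base b)
    then show ?case using mono by auto
  next
    case (step b c)
    then show ?case using mono[OF step.hyps(2)]
      by (auto intro: trancl.trancl_into_trancl)
  qed
  show ?thesis
  proof (rule acyclicI, intro allI notI)
    fix a assume "(a, a) \<in> R\<^sup>+"
    from *[OF this] show False using level[of "r a"] by (auto simp: acyclic_def)
  qed
qed

lemma acyclic_no_3cycle: "acyclic R \<Longrightarrow> (a, b) \<in> R \<Longrightarrow> (b, c) \<in> R \<Longrightarrow> (c, a) \<notin> R"
  by (meson acyclic_def trancl.intros)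

section \<open>Decycling a dijoin\<close>

lemma labelling_dijoin_right:
  assumes "decycling_labelling (dijoin L D) I f"
  shows "decycling_labelling D I (\<lambda>z. f (Inr z))"
proof -
  have "reorient D (\<lambda>u v. dot I (f (Inr u)) (f (Inr v)))
      \<subseteq> inv_image (reorient (dijoin L D) (\<lambda>u v. dot I (f u) (f v))) Inr"
    by (auto simp: reorient_def dijoin_def split: if_splits)
  then show ?thesis
    using assms acyclic_inv_image acyclic_subset unfolding decycling_labelling_def by blast
qed

lemma inversion_number_dijoin_ge:
  assumes "oriented_graph L" "oriented_graph D"
  shows "inversion_number D \<le> inversion_number (dijoin L D)"
proof -
  obtain Xs where "k_decycling_family (inversion_number (dijoin L D)) (dijoin L D) Xs"
    using inversion_number_attained[OF oriented_graph_dijoin[OF assms]] by blast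
  from labelling_dijoin_right[OF labelling_of_family[OF this]] show ?thesis
    using inversion_number_le_labelling[OF assms(2) finite_lessThan] by (metis card_lessThan)
qed

text \<open>
  Only an arc \<open>p \<rightarrow> x\<close> of \<open>L\<close> that gets reversed is used, and one exists because otherwise the cycle of
  \<open>L\<close> would survive. The orthogonal vector \<open>u\<close> is the label of \<open>x\<close>, which is nonzero because its
  product with the label of \<open>p\<close> is \<open>1\<close>.
\<close>

lemma dijoin_labelling_hyperplane:
  assumes L: "oriented_graph L" and cyc: "\<not> acyclic (parcs L)"
    and f: "decycling_labelling (dijoin L D) I f" and D: "oriented_graph D"
  obtains g u where "decycling_labelling D I g" "\<exists>i\<in>I. u i = 1"
    "\<And>z. z \<in> pverts D \<Longrightarrow> dot I u (g z) = 0"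
proof -
  interpret L: oriented_graph L by fact
  interpret D: oriented_graph D by fact
  let ?R = "reorient (dijoin L D) (\<lambda>a b. dot I (f a) (f b))"
  have acyc: "acyclic ?R" using f by (simp add: decycling_labelling_def)
  obtain p x where px: "(p, x) \<in> parcs L" and rev: "dot I (f (Inl p)) (f (Inl x)) = 1"
  proof -
    have False if "\<forall>(p, x) \<in> parcs L. dot I (f (Inl p)) (f (Inl x)) \<noteq> 1"
    proof -
      have "parcs L \<subseteq> inv_image ?R Inl"
        using that by (auto simp: reorient_def dijoin_def)
      then show False using acyclic_inv_image[OF acyc] acyclic_subset cyc by blast
    qed
    then show ?thesis using that by blast
  qed
  have verts: "p \<in> pverts L" "x \<in> pverts L" using px L.wellformed' by auto
  define F where "F z = f (Inr z)" for z
  define P where "P = f (Inl p)"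
  define X where "X = f (Inl x)"
  have XP: "dot I X P = 1" using rev by (simp add: P_def X_def dot_commute)
  have arc_xp: "(Inl x, Inl p) \<in> ?R"
    using px rev by (auto simp: reorient_def dijoin_def dot_commute)
  have arc_L: "if dot I (f (Inl c)) (F z) = 1 then (Inr z, Inl c) \<in> ?R else (Inl c, Inr z) \<in> ?R"
    if "c \<in> pverts L" "z \<in> pverts D" for c z
    using that by (auto simp: reorient_def dijoin_def F_def dot_commute)
  have arc_D: "(Inr a, Inr b) \<in> ?R \<longleftrightarrow> (a, b) \<in> reorient D (\<lambda>u v. dot I (F u) (F v))" for a b
    by (auto simp: reorient_def dijoin_def F_def)
  let ?Q = "reorient D (\<lambda>u v. dot I (F u) (F v))"
  have Q: "acyclic ?Q"
    using labelling_dijoin_right[OF f] by (simp add: decycling_labelling_def F_def)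
  have Q_verts: "a \<in> pverts D" "b \<in> pverts D" if "(a, b) \<in> ?Q" for a b
    using that D.wellformed' by (auto simp: reorient_def split: if_splits)
  \<comment> \<open>A vertex before \<open>x\<close> and after \<open>p\<close> would close a triangle with the arc from \<open>x\<close> to \<open>p\<close>.\<close>
  have before_p: "dot I P (F z) = 1" if "z \<in> pverts D" "dot I X (F z) = 1" for z
    using arc_L[OF verts(1) that(1)] arc_L[OF verts(2) that(1)] that(2)
      acyclic_no_3cycle[OF acyc _ arc_xp]
    by (auto simp: P_def X_def split: if_splits)
  \<comment> \<open>Whatever precedes a vertex that is before \<open>c\<close> is itself before \<open>c\<close>.\<close>
  have mono: "dot I (f (Inl c)) (F b) = 1 \<Longrightarrow> dot I (f (Inl c)) (F a) = 1"
    if "c \<in> pverts L" "(a, b) \<in> ?Q" for a b c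
    using arc_L[OF that(1) Q_verts(1)[OF that(2)]] arc_L[OF that(1) Q_verts(2)[OF that(2)]]
      acyclic_no_3cycle[OF acyc, of "Inr a" "Inr b" "Inl c"] that(2) arc_D[of a b]
    by (auto split: if_splits)
  define g where "g z = (if dot I X (F z) = 1 then (\<lambda>i. F z i + P i) else F z)" for z
  have orth: "dot I X (g z) = 0" for z
    using XP by (cases "dot I X (F z)") (auto simp: g_def dot_add_right)
  \<comment> \<open>The vertices before \<open>x\<close>, whose labels are shifted, now come after those between \<open>x\<close> and \<open>p\<close>:
    arcs between these two classes are flipped because the latter have product \<open>1\<close> with \<open>p\<close>.\<close>
  define r :: "'b \<Rightarrow> nat" where
    "r z = (if dot I X (F z) = 1 then 1 else if dot I P (F z) = 1 then 0 else 2)" for z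
  have r_eq_1: "r z = 1 \<longleftrightarrow> dot I X (F z) = 1" for z
    by (simp add: r_def)
  let ?N = "reorient D (\<lambda>u v. dot I (g u) (g v))"
  have g_dot: "dot I (g a) (g b) = dot I (F a) (F b)
      + of_bool (dot I X (F a) = 1) * dot I P (F b)
      + of_bool (dot I X (F b) = 1) * dot I P (F a)
      + of_bool (dot I X (F a) = 1 \<and> dot I X (F b) = 1) * dot I P P" for a b
    by (simp add: g_def dot_add_left dot_add_right dot_commute add_ac)
  have N_verts: "a \<in> pverts D \<and> b \<in> pverts D" if "(a, b) \<in> ?N" for a b
    using that D.wellformed' by (auto simp: reorient_def split: if_splits)
  have N_Q: "if dot I (g a) (g b) = dot I (F a) (F b) then (a, b) \<in> ?Q else (b, a) \<in> ?Q"
    if "(a, b) \<in> ?N" for a b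
    using that dot_commute[of I "F a" "F b"] by (auto simp: reorient_def split: if_splits)
  have "acyclic ?N"
  proof (rule acyclic_levels[where r = r])
    fix a b assume ab: "(a, b) \<in> ?N"
    have mono_X: "(a', b') \<in> ?Q \<Longrightarrow> dot I X (F b') = 1 \<Longrightarrow> dot I X (F a') = 1" for a' b'
      using mono[OF verts(2)] by (simp add: X_def)
    show "r a \<le> r b"
    proof (cases "dot I X (F a) = 1"; cases "dot I X (F b) = 1")
      assume "dot I X (F a) = 1" "dot I X (F b) = 1"
      then show ?thesis by (simp add: r_def)
    next
      assume X: "dot I X (F a) = 1" "dot I X (F b) \<noteq> 1"
      have "dot I P (F b) \<noteq> 1"
      proof
        assume "dot I P (F b) = 1"
        then have "dot I (g a) (g b) \<noteq> dot I (F a) (F b)" using X by (simp add: g_dot)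
        then have "(b, a) \<in> ?Q" using N_Q[OF ab] by (simp only: if_False)
        then show False using mono_X X by blast
      qed
      then show ?thesis using X by (simp add: r_def)
    next
      assume X: "dot I X (F a) \<noteq> 1" "dot I X (F b) = 1"
      have "dot I P (F a) = 1"
      proof (rule ccontr)
        assume "dot I P (F a) \<noteq> 1"
        then have "dot I (g a) (g b) = dot I (F a) (F b)" using X by (simp add: g_dot)
        then have "(a, b) \<in> ?Q" using N_Q[OF ab] by (simp only: if_True)
        then show False using mono_X X by blast
      qed
      then show ?thesis using X by (simp add: r_def)
    next
      assume X: "dot I X (F a) \<noteq> 1" "dot I X (F b) \<noteq> 1"
      then have "dot I (g a) (g b) = dot I (F a) (F b)" by (simp add: g_dot)
      then have "(a, b) \<in> ?Q" using N_Q[OF ab] by (simp only: if_True)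
      then have "dot I P (F b) = 1 \<Longrightarrow> dot I P (F a) = 1"
        using mono[OF verts(1)] by (simp add: P_def)
      then show ?thesis using X by (simp add: r_def)
    qed
  next
    fix n
    show "acyclic {(a, b) \<in> ?N. r a = n \<and> r b = n}" (is "acyclic ?M")
    proof (cases "n = 1 \<and> dot I P P = 1")
      case True
      \<comment> \<open>Within the shifted class the product changes by \<open>1 + 1 + p \<bullet> p\<close>.\<close>
      have "(a, b) \<in> ?Q\<inverse>" if "(a, b) \<in> ?N" "r a = n" "r b = n" for a b
      proof -
        have X: "dot I X (F a) = 1" "dot I X (F b) = 1"
          using True that(2,3) r_eq_1 by blast+
        then have "dot I P (F a) = 1" "dot I P (F b) = 1"
          using before_p N_verts[OF that(1)] by blast+
        then have "dot I (g a) (g b) \<noteq> dot I (F a) (F b)"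
          using True X by (simp add: g_dot)
        then show ?thesis
          using N_Q[OF that(1)] by (simp only: if_False converse_iff)
      qed
      then have "?M \<subseteq> ?Q\<inverse>" by blast
      moreover have "acyclic (?Q\<inverse>)" using Q by (simp only: acyclic_converse)
      ultimately show ?thesis by (rule acyclic_subset[rotated])
    next
      case False
      have "(a, b) \<in> ?Q" if "(a, b) \<in> ?N" "r a = n" "r b = n" for a b
      proof -
        have "dot I (g a) (g b) = dot I (F a) (F b)"
        proof (cases "n = 1")
          case True
          then have X: "dot I X (F a) = 1" "dot I X (F b) = 1"
            using that(2,3) r_eq_1 by blast+
          then have "dot I P (F a) = 1" "dot I P (F b) = 1"
            using before_p N_verts[OF that(1)] by blast+
          moreover have "dot I P P = 0" using False True by simp
          ultimately show ?thesis using X by (simp add: g_dot)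
        next
          case False
          then have "dot I X (F a) \<noteq> 1" "dot I X (F b) \<noteq> 1"
            using that(2,3) by (simp_all flip: r_eq_1)
          then show ?thesis by (simp add: g_dot)
        qed
        then show ?thesis using N_Q[OF that(1)] by (simp only: if_True)
      qed
      then have "?M \<subseteq> ?Q" by blast
      with Q show ?thesis by (rule acyclic_subset)
    qed
  qed
  moreover have "\<exists>i\<in>I. X i = 1"
  proof (rule ccontr)
    assume "\<not> (\<exists>i\<in>I. X i = 1)"
    then have "dot I X P = 0" by (auto simp: dot_def intro!: sum.neutral)
    then show False using XP by simp
  qed
  ultimately show ?thesis using that orth by (auto simp: decycling_labelling_def)
qed

lemma not_acyclic_C3: "\<not> acyclic (parcs C3)"
  using acyclic_no_3cycle[of "parcs C3" 0 1 2] by (auto simp: C3_def)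

lemma dijoin_C3_labelling:
  assumes f: "decycling_labelling D I f" and odd: "odd (card I)"
    and even: "\<And>z. z \<in> pverts D \<Longrightarrow> (\<Sum>i\<in>I. f z i) = 0"
  shows "decycling_labelling (dijoin C3 D) I (case_sum (\<lambda>c i. of_bool (c \<noteq> 2)) f)"
proof -
  define g where "g = case_sum (\<lambda>c i. of_bool (c \<noteq> (2 :: nat))) f"
  let ?R = "reorient (dijoin C3 D) (\<lambda>a b. dot I (g a) (g b))"
  let ?Q = "reorient D (\<lambda>u v. dot I (f u) (f v))"
  have g_C3: "dot I (g (Inl c)) (g (Inl d)) = of_bool (c \<noteq> 2 \<and> d \<noteq> 2)" for c d
    using odd by (cases "c = 2"; cases "d = 2") (simp_all add: g_def dot_def of_nat_bit)
  have g_mixed: "dot I (g (Inl c)) (g (Inr z)) = 0" "dot I (g (Inr z)) (g (Inl c)) = 0"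
    if "z \<in> pverts D" for c z
    using even[OF that] by (cases "c = 2"; simp add: g_def dot_def)+
  have g_D: "g (Inr z) = f z" for z
    by (simp add: g_def)
  have R_C3: "(Inl c, Inl d) \<in> ?R \<longleftrightarrow> (c, d) \<in> {(1, 0), (1, 2), (2, 0)}" for c d
    by (auto simp: reorient_def dijoin_def C3_def g_C3)
  have R_mixed: "(Inr z, Inl c) \<notin> ?R" for z c
    by (auto simp: reorient_def dijoin_def g_mixed)
  have R_D: "(Inr y, Inr z) \<in> ?R \<longleftrightarrow> (y, z) \<in> ?Q" for y z
    by (auto simp: reorient_def dijoin_def g_D)
  \<comment> \<open>Only the arc from \<open>0\<close> to \<open>1\<close> is reversed, so the triangle takes the order \<open>1\<close>, \<open>2\<close>, \<open>0\<close>,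
    ahead of all of \<open>D\<close>.\<close>
  define r :: "nat + 'a \<Rightarrow> nat" where
    "r = case_sum (\<lambda>c. if c = 1 then 0 else if c = 2 then 1 else 2) (\<lambda>z. 3)"
  have "acyclic ?R"
  proof (rule acyclic_levels[where r = r])
    fix a b assume "(a, b) \<in> ?R"
    then show "r a \<le> r b"
      by (cases a; cases b) (auto simp: R_C3 R_mixed r_def)
  next
    fix n
    have "(a, b) \<in> inv_image ?Q projr" if "(a, b) \<in> ?R" "r a = r b" for a b
      using that by (cases a; cases b) (auto simp: R_C3 R_mixed R_D r_def split: if_splits)
    then have "{(a, b) \<in> ?R. r a = n \<and> r b = n} \<subseteq> inv_image ?Q projr"
      by (intro subrelI) (simp del: in_inv_image)
    moreover have "acyclic (inv_image ?Q projr)"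
      using f unfolding decycling_labelling_def by (rule acyclic_inv_image)
    ultimately show "acyclic {(a, b) \<in> ?R. r a = n \<and> r b = n}"
      by (rule acyclic_subset[rotated])
  qed
  then show ?thesis by (simp add: decycling_labelling_def g_def)
qed

theorem lemma2p6:
  fixes D :: "'a pair_pre_digraph" and k :: nat
  assumes "oriented_graph D"
    and "inversion_number D = k"
    and "k \<ge> 3"
  shows "inversion_number (dijoin C3 D) = k \<longleftrightarrow>
    odd k \<and>
    (\<exists>Xs. k_decycling_family k D Xs \<and>
      {char_vec Xs z | z. z \<in> pverts D} \<subseteq> {x \<in> carrier_vec k. x \<bullet> ones_vec k = 0})"
proof
  assume "inversion_number (dijoin C3 D) = k"
  then obtain Ys where "k_decycling_family k (dijoin C3 D) Ys"
    using inversion_number_attained[OF oriented_graph_dijoin[OF oriented_graph_C3 assms(1)]] by blast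
  from dijoin_labelling_hyperplane[OF oriented_graph_C3 not_acyclic_C3 labelling_of_family[OF this]
      assms(1)]
  obtain g u i\<^sub>0 where g: "decycling_labelling D {..<k} g" and u: "i\<^sub>0 \<in> {..<k}" "u i\<^sub>0 = 1"
    and orth: "\<And>z. z \<in> pverts D \<Longrightarrow> dot {..<k} u (g z) = 0"
    by metis
  have min: "inversion_number D = card {..<k}" using assms(2) by simp
  have odd: "odd k" and ones: "\<forall>i\<in>{..<k}. u i = 1"
    using minimal_labelling_hyperplane[OF assms(1) finite_lessThan g min u orth] by auto
  obtain Xs where Xs: "k_decycling_family k D Xs"
    "\<forall>z\<in>pverts D. char_vec Xs z \<bullet> ones_vec k = (\<Sum>i<k. g z i)"
    using family_of_labelling[OF assms(1) finite_lessThan card_lessThan g] by blast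
  have "(\<Sum>i<k. g z i) = 0" if "z \<in> pverts D" for z
    using orth[OF that] ones by (simp add: dot_def)
  moreover have "char_vec Xs z \<in> carrier_vec k" for z
    using Xs(1) by (auto simp: char_vec_def k_decycling_family_def)
  ultimately show "odd k \<and> (\<exists>Xs. k_decycling_family k D Xs \<and>
      {char_vec Xs z | z. z \<in> pverts D} \<subseteq> {x \<in> carrier_vec k. x \<bullet> ones_vec k = 0})"
    using odd Xs by (intro conjI exI[of _ Xs]) auto
next
  assume "odd k \<and> (\<exists>Xs. k_decycling_family k D Xs \<and>
      {char_vec Xs z | z. z \<in> pverts D} \<subseteq> {x \<in> carrier_vec k. x \<bullet> ones_vec k = 0})"
  then obtain Xs where odd: "odd k" and Xs: "k_decycling_family k D Xs"
    and orth: "\<And>z. z \<in> pverts D \<Longrightarrow> char_vec Xs z \<bullet> ones_vec k = 0"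
    by blast
  have len: "length Xs = k" using Xs by (simp add: k_decycling_family_def)
  have even: "(\<Sum>i<k. of_bool (z \<in> Xs ! i) :: bit) = 0" if "z \<in> pverts D" for z
    using orth[OF that]
    by (simp add: scalar_prod_def char_vec_def ones_vec_def len atLeast0LessThan of_bool_def)
  have odd': "odd (card {..<k})" using odd by simp
  have "inversion_number (dijoin C3 D) \<le> k"
    using inversion_number_le_labelling[OF oriented_graph_dijoin[OF oriented_graph_C3 assms(1)]
        finite_lessThan dijoin_C3_labelling[OF labelling_of_family[OF Xs] odd' even]]
    by simp
  then show "inversion_number (dijoin C3 D) = k"
    using inversion_number_dijoin_ge[OF oriented_graph_C3 assms(1)] assms(2) by simp
qed

end
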